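(* For every real $x>0$, let $A(x)=K_0(x)\,\mathbf{L}_{-1}(x)+K_1(x)\,\mathbf{L}_0(x)$. Then the Bickley-Naylor functions of orders $2,3,4$ are given, for every real $x>0$, by $$Ki_2(x) = -\frac{\pi x}{2} + x K_1(x) + \frac{\pi x^2}{2}\left[K_0(x)\,\mathbf{L}_{-1}(x)+K_1(x)\,\mathbf{L}_0(x)\right] = P_2(x)K_1(x)+Q_2(x)A(x)+C_2(x),$$ where $P_2(x)=x$, $Q_2(x)=\frac{\pi x^2}{2}$, $C_2(x)=-\frac{\pi x}{2}$; $$Ki_3(x) = \frac{\pi(1+x^2)}{4}+\frac{x}{2}K_0(x)-\frac{x^2}{2}K_1(x)-\frac{\pi x(1+x^2)}{4}\left[K_0(x)\,\mathbf{L}_{-1}(x)+K_1(x)\,\mathbf{L}_0(x)\right] = P_3(x)K_1(x)+R_3(x)K_0(x)+Q_3(x)A(x)+C_3(x),$$ where $P_3(x)=-\frac{x^2}{2}$, $R_3(x)=\frac{x}{2}$, $Q_3(x)=-\frac{\pi x(1+x^2)}{4}$, $C_3(x)=\frac{\pi(1+x^2)}{4}$; and $$Ki_4(x) = -\frac{\pi x(3+x^2)}{12}-\frac{x^2}{6}K_0(x)+\frac{x(4+x^2)}{6}K_1(x)+\frac{\pi x^2(3+x^2)}{12}\left[K_0(x)\,\mathbf{L}_{-1}(x)+K_1(x)\,\mathbf{L}_0(x)\right] = P_4(x)K_1(x)+R_4(x)K_0(x)+Q_4(x)A(x)+C_4(x),$$ where $P_4(x)=\frac{x(4+x^2)}{6}$,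 $Q_4(x)=\frac{\pi x^2(3+x^2)}{12}$, $R_4(x)=-\frac{x^2}{6}$, $C_4(x)=-\frac{\pi x(3+x^2)}{12}$.
   Context: For an integer $n\ge 0$ and real $x>0$, the Bickley-Naylor function of order $n$ is $$Ki_n(x)=\int_0^{\pi/2} e^{-x\sec\theta}\cos^{n-1}\theta\,d\theta=\int_0^\infty e^{-x\cosh t}\cosh^{-n}t\,dt .$$ For $x>0$, $K_\nu(x)=\int_0^\infty e^{-x\cosh t}\cosh(\nu t)\,dt$ is the modified Bessel function of the second kind, and $$\mathbf{L}_\nu(x)=\sum_{m=0}^\infty \frac{(x/2)^{2m+\nu+1}}{\Gamma(m+\frac32)\,\Gamma(m+\nu+\frac32)}$$ is the modified Struve function of order $\nu$ (used here for $\nu=0$ and $\nu=-1$). *)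

theory Defs
  imports "HOL-Analysis.Analysis"
begin

(* The exponent n - 1 is taken in the integers, so that n = 0 gives cos t powi (-1).
   At the endpoint t = pi/2 the integrand has the value assigned by division by zero;
   a single point does not affect the integral. *)
definition Ki :: "nat \<Rightarrow> real \<Rightarrow> real" where
  "Ki n x = integral {0..pi/2} (\<lambda>t. exp (- (x / cos t)) * cos t powi (int n - 1))"

definition bessel_K :: "real \<Rightarrow> real \<Rightarrow> real" where
  "bessel_K \<nu> x = integral {0..} (\<lambda>t. exp (- (x * cosh t)) * cosh (\<nu> * t))"

(* Meant for x > 0, because of the real exponent. At a pole of Gamma the library sets
   Gamma to 0, so the term is 0, in agreement with the convention 1 / Gamma = 0 there. *)
definition struve_L :: "real \<Rightarrow> real \<Rightarrow> real" where
  "struve_L \<nu> x =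
     (\<Sum>m. (x / 2) powr (2 * real m + \<nu> + 1) /
           (Gamma (real m + 3/2) * Gamma (real m + \<nu> + 3/2)))"

definition bickley_A :: "real \<Rightarrow> real" where
  "bickley_A x = bessel_K 0 x * struve_L (-1) x + bessel_K 1 x * struve_L 0 x"

definition P2 :: "real \<Rightarrow> real" where "P2 x = x"
definition Q2 :: "real \<Rightarrow> real" where "Q2 x = pi * x^2 / 2"
definition C2 :: "real \<Rightarrow> real" where "C2 x = - (pi * x / 2)"

definition P3 :: "real \<Rightarrow> real" where "P3 x = - (x^2 / 2)"
definition R3 :: "real \<Rightarrow> real" where "R3 x = x / 2"
definition Q3 :: "real \<Rightarrow> real" where "Q3 x = - (pi * x * (1 + x^2) / 4)"
definition C3 :: "real \<Rightarrow> real" where "C3 x = pi * (1 + x^2) / 4"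

definition P4 :: "real \<Rightarrow> real" where "P4 x = x * (4 + x^2) / 6"
definition R4 :: "real \<Rightarrow> real" where "R4 x = - (x^2 / 6)"
definition Q4 :: "real \<Rightarrow> real" where "Q4 x = pi * x^2 * (3 + x^2) / 12"
definition C4 :: "real \<Rightarrow> real" where "C4 x = - (pi * x * (3 + x^2) / 12)"

end

(* Substituting cos \<theta> = 1 / cosh t turns Ki n, K_0 and K_1 into the moments
   M_k(x) = \<integral> exp (- x cosh t) cosh^k t dt over t \<ge> 0, with k = -n, 0, 1. Here M_k' = - M_(k+1), and
   integrating the derivative of exp (- x cosh t) sinh t cosh^k t gives a four-term recurrence
   that reduces Ki 2, Ki 3, Ki 4 to K_0, K_1 and Ki 1.
   It remains to see that Ki 1 + (\<pi>/2) x A is the constant \<pi>/2. The derivative vanishes because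
   L_0' = L_(-1), (x L_(-1))' = 2/\<pi> + x L_0, K_0' = - K_1 and (x K_1)' = - x K_0 give
   (x A)' = (2/\<pi>) K_0. The constant is found by letting x tend to 0. *)

theory Submission
  imports Defs
begin

section \<open>Improper integrals, a derivative criterion and exponential bounds\<close>

text \<open>The ordinary fundamental theorem evaluates the truncations of \<open>f\<close> to
  \<open>{a..a + real k}\<close>; dominated convergence with majorant \<open>h\<close> passes to the
  half-line.\<close>

lemma integral_atLeast_FTC:
  fixes f F h :: "real \<Rightarrow> real"
  assumes deriv: "\<And>t. (F has_field_derivative f t) (at t)"
    and h: "h integrable_on {a..}" and bound: "\<And>t. t \<ge> a \<Longrightarrow> \<bar>f t\<bar> \<le> h t"
    and lim: "(F \<longlongrightarrow> L) at_top"
  shows "integral {a..} f = L - F a"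
proof -
  have ftc: "(f has_integral (F (a + real k) - F a)) {a..a + real k}" for k
    by (intro fundamental_theorem_of_calculus)
       (auto simp: has_real_derivative_iff_has_vector_derivative[symmetric]
          intro: has_field_derivative_at_within deriv)
  define g where "g = (\<lambda>(k::nat) t. if t \<in> {a..a + real k} then f t else 0)"
  have g: "(g k has_integral (F (a + real k) - F a)) {a..}" for k
    unfolding g_def by (subst has_integral_restrict) (use ftc in auto)
  have "(\<lambda>k. integral {a..} (g k)) \<longlonglongrightarrow> integral {a..} f"
  proof (rule dominated_convergence(2))
    show "g k integrable_on {a..}" for k
      using g by blast
    show "norm (g k t) \<le> h t" if "t \<in> {a..}" for k t
      using bound[of t] that by (auto simp: g_def)
    show "(\<lambda>k. g k t) \<longlonglongrightarrow> f t" if "t \<in> {a..}" for t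
    proof (rule tendsto_eventually)
      have "eventually (\<lambda>k. k \<ge> nat \<lceil>t - a\<rceil>) sequentially"
        by (rule eventually_ge_at_top)
      thus "\<forall>\<^sub>F k in sequentially. g k t = f t"
      proof eventually_elim
        case (elim k)
        hence "t \<le> a + real k" by linarith
        thus ?case using that by (simp add: g_def)
      qed
    qed
  qed (rule h)
  moreover have "(\<lambda>k. integral {a..} (g k)) = (\<lambda>k. F (a + real k) - F a)"
    using g by (auto simp: integral_unique)
  moreover have "(\<lambda>k. F (a + real k) - F a) \<longlonglongrightarrow> L - F a"
  proof (intro tendsto_intros filterlim_compose[OF lim])
    show "filterlim (\<lambda>k. a + real k) at_top sequentially"
      by (rule filterlim_tendsto_add_at_top[OF tendsto_const filterlim_real_sequentially])
  qed
  ultimately show ?thesis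
    by (metis LIMSEQ_unique)
qed

text \<open>After division by \<open>h\<close> the error is at most
  \<open>C * \<bar>h\<bar>\<close>. This form suits parameter integrals, where a pointwise remainder
  bound can simply be integrated.\<close>

lemma has_field_derivative_quadratic_remainder:
  fixes f :: "real \<Rightarrow> real"
  assumes d: "d > 0"
    and rem: "\<And>h. \<bar>h\<bar> < d \<Longrightarrow> \<bar>f (x + h) - f x - h * D\<bar> \<le> C * h\<^sup>2"
  shows "(f has_field_derivative D) (at x)"
proof -
  have "((\<lambda>h. (f (x + h) - f x - h * D) / h) \<longlongrightarrow> 0) (at 0)"
  proof (rule Lim_null_comparison)
    have "eventually (\<lambda>h::real. \<bar>h\<bar> < d \<and> h \<noteq> 0) (at 0)"
      using d by (auto simp: eventually_at intro!: exI[of _ d])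
    thus "\<forall>\<^sub>F h in at 0. norm ((f (x + h) - f x - h * D) / h) \<le> C * \<bar>h\<bar>"
    proof eventually_elim
      case (elim h)
      with rem[of h] show ?case
        by (auto simp: field_simps abs_mult power2_eq_square)
    qed
    show "((\<lambda>h. C * \<bar>h\<bar>) \<longlongrightarrow> 0) (at 0)"
      by (rule tendsto_eq_intros | simp)+
  qed
  hence "((\<lambda>h. D + (f (x + h) - f x - h * D) / h) \<longlongrightarrow> D + 0) (at 0)"
    by (intro tendsto_intros)
  moreover have "\<forall>\<^sub>F h in at 0. D + (f (x + h) - f x - h * D) / h = (f (x + h) - f x) / h"
    unfolding eventually_at_filter by (auto simp: field_simps)
  ultimately show ?thesis
    unfolding DERIV_def by (simp add: Lim_transform_eventually)
qed

text \<open>Multiplying \<open>1 - v \<le> exp (- v)\<close> by \<open>exp v\<close> gives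
  \<open>exp v - 1 \<le> v * exp v\<close>. Hence the remainder is at most
  \<open>v * (exp v - 1)\<close>, and bounding the second factor by
  \<open>\<bar>v\<bar> * exp \<bar>v\<bar>\<close> yields the square.\<close>

lemma exp_remainder_le:
  fixes v :: real
  shows "\<bar>exp v - 1 - v\<bar> \<le> v\<^sup>2 * exp \<bar>v\<bar>"
proof -
  have lower: "0 \<le> exp v - 1 - v"
    using exp_ge_add_one_self[of v] by linarith
  have "(1 - v) * exp v \<le> exp (- v) * exp v"
    by (intro mult_right_mono) (use exp_ge_add_one_self[of "-v"] in auto)
  hence upper: "exp v - 1 \<le> v * exp v"
    by (simp add: exp_minus algebra_simps)
  have "\<bar>exp v - 1\<bar> \<le> \<bar>v\<bar> * exp \<bar>v\<bar>"
  proof (cases "v \<ge> 0")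
    case True
    thus ?thesis using upper by simp
  next
    case False
    moreover have "\<bar>v\<bar> * 1 \<le> \<bar>v\<bar> * exp \<bar>v\<bar>"
      by (intro mult_left_mono) auto
    moreover have "\<bar>exp v - 1\<bar> \<le> \<bar>v\<bar> * 1"
      using False exp_ge_add_one_self[of v] by (simp add: abs_if del: exp_ge_add_one_self)
    ultimately show ?thesis by linarith
  qed
  hence "\<bar>v\<bar> * \<bar>exp v - 1\<bar> \<le> \<bar>v\<bar> * (\<bar>v\<bar> * exp \<bar>v\<bar>)"
    by (intro mult_left_mono) auto
  moreover have "v * (exp v - 1) \<le> \<bar>v\<bar> * \<bar>exp v - 1\<bar>"
    by (metis abs_ge_self abs_mult)
  moreover have "exp v - 1 - v \<le> v * (exp v - 1)"
    using upper by (simp add: algebra_simps)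
  ultimately show ?thesis
    using lower by (simp add: power2_eq_square mult.assoc)
qed

text \<open>Raising y \<le> exp y at y = x c / m to the power m bounds c^m by a multiple of exp (x
  c). The form \<open>C / c\<close> makes 1 / cosh a majorant after putting c = cosh t.\<close>

lemma exp_mult_powi_le:
  fixes x :: real
  assumes "x > 0"
  obtains C where "\<And>c. c \<ge> 1 \<Longrightarrow> exp (- (x * c)) * c powi k \<le> C / c"
proof -
  \<comment> \<open>Chosen so that m \<ge> k + 1 for integers \<open>k\<close> of either sign, and m
    > 0 so that division by m is meaningful.\<close>
  define m where "m = Suc (nat (k + 1))"
  have "exp (- (x * c)) * c powi k \<le> (real m / x) ^ m / c" if c: "c \<ge> 1" for c
  proof -
    have "c powi (k + 1) \<le> c powi int m"
      by (intro power_int_increasing) (use c in \<open>auto simp: m_def\<close>)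
    hence 1: "c powi k * c \<le> c ^ m"
      using c by (simp add: power_int_add)
    have "x * c / real m \<le> exp (x * c / real m)"
      using exp_ge_add_one_self[of "x * c / real m"] by linarith
    hence "(x * c / real m) ^ m \<le> exp (x * c / real m) ^ m"
      by (intro power_mono) (use assms c in auto)
    also have "\<dots> = exp (x * c)"
      by (subst exp_of_nat_mult[symmetric]) (simp add: m_def)
    finally have "(x * c / real m) ^ m * (real m / x) ^ m \<le> exp (x * c) * (real m / x) ^ m"
      by (intro mult_right_mono) (use assms in auto)
    also have "(x * c / real m) ^ m * (real m / x) ^ m = c ^ m"
      unfolding power_mult_distrib[symmetric] using assms by (simp add: m_def)
    finally have "c ^ m \<le> exp (x * c) * (real m / x) ^ m" .
    with 1 have "c powi k * c \<le> exp (x * c) * (real m / x) ^ m"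
      by linarith
    hence "exp (- (x * c)) * (c powi k * c) \<le> exp (- (x * c)) * (exp (x * c) * (real m / x) ^ m)"
      by (intro mult_left_mono) auto
    also have "\<dots> = (real m / x) ^ m"
      by (simp add: exp_minus)
    finally show ?thesis
      using c by (simp add: pos_le_divide_eq mult.assoc)
  qed
  thus ?thesis by (rule that)
qed

section \<open>Moments: integrability, recurrence and derivative\<close>

text \<open>For x > 0, nonnegative \<open>k\<close> gives, up to sign, the k-th derivative of K_0,
  and negative \<open>k\<close> its iterated integrals. The integer exponent lets one recurrence and
  one derivative rule serve both.\<close>

definition exp_cosh_moment :: "int \<Rightarrow> real \<Rightarrow> real" where
  "exp_cosh_moment k x = integral {0..} (\<lambda>t. exp (- (x * cosh t)) * cosh t powi k)"

lemma integrable_inverse_cosh: "(\<lambda>t::real. 1 / cosh t) integrable_on {0..}"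
proof (rule measurable_bounded_by_integrable_imp_integrable)
  show "(\<lambda>t. 1 / cosh t) \<in> borel_measurable (lebesgue_on {0::real..})"
    by (intro continuous_imp_measurable_on_sets_lebesgue continuous_intros) auto
  show "(\<lambda>t::real. 2 * exp (-1 * t)) integrable_on {0..}"
    by (intro integrable_on_mult_right integrable_on_exp_minus_to_infinity) auto
  show "norm (1 / cosh t) \<le> 2 * exp (-1 * t)" for t :: real
  proof -
    have "exp t / 2 \<le> cosh t" by (simp add: cosh_field_def)
    hence "1 / cosh t \<le> 1 / (exp t / 2)" by (intro divide_left_mono) auto
    thus ?thesis by (simp add: exp_minus field_simps)
  qed
qed auto

lemma integrable_if_le_cosh:
  fixes f :: "real \<Rightarrow> real"
  assumes "continuous_on {0..} f" "\<And>t. t \<ge> 0 \<Longrightarrow> \<bar>f t\<bar> \<le> C / cosh t"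
  shows "f integrable_on {0..}"
proof (rule measurable_bounded_by_integrable_imp_integrable)
  show "(\<lambda>t. C * (1 / cosh t)) integrable_on {0..}"
    by (intro integrable_on_mult_right integrable_inverse_cosh)
  show "f \<in> borel_measurable (lebesgue_on {0..})"
    by (intro continuous_imp_measurable_on_sets_lebesgue assms) auto
qed (use assms in auto)

text \<open>For x > 0 the exponential outweighs every power of cosh; at x = 0 the power alone must
  decay like 1 / cosh. The case x = 0 serves to fix the constant of integration later.\<close>

lemma exp_cosh_powi_integrable:
  assumes "x > 0 \<or> x = 0 \<and> k \<le> -1"
  shows "(\<lambda>t::real. exp (- (x * cosh t)) * cosh t powi k) integrable_on {0..}"
proof -
  obtain C where C: "exp (- (x * c)) * c powi k \<le> C / c" if "c \<ge> 1" for c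
  proof (cases "x > 0")
    case True
    thus ?thesis using exp_mult_powi_le that by blast
  next
    case False
    have "c powi k \<le> 1 / c" if "c \<ge> 1" for c :: real
      using power_int_increasing[of k "-1" c] False assms that
      by (simp add: power_int_minus divide_inverse)
    thus ?thesis using that[of 1] False assms by auto
  qed
  show ?thesis
  proof (rule integrable_if_le_cosh)
    show "\<bar>exp (- (x * cosh t)) * cosh t powi k\<bar> \<le> C / cosh t" for t
      using C[OF cosh_real_ge_1[of t]] by (simp add: abs_mult)
  qed (intro continuous_intros, auto)
qed

text \<open>Replacing sinh^2 by cosh^2 - 1 turns the derivative of \<open>F\<close> into a
  combination of four integrands. Both boundary terms vanish: sinh 0 = 0, and \<open>F\<close>
  decays at infinity.\<close>

lemma exp_cosh_moment_recurrence:
  assumes x: "x > 0"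
  shows "x * exp_cosh_moment (k + 2) x =
    x * exp_cosh_moment k x + (1 + k) * exp_cosh_moment (k + 1) x - k * exp_cosh_moment (k - 1) x"
proof -
  define E where "E = (\<lambda>j t. exp (- (x * cosh t)) * cosh t powi j :: real)"
  have int: "E j integrable_on {0..}" for j
    unfolding E_def using exp_cosh_powi_integrable x by blast
  define f where "f = (\<lambda>t. x * E k t + (1 + k) * E (k + 1) t - k * E (k - 1) t - x * E (k + 2) t)"
  define h where "h = (\<lambda>t. x * E k t + \<bar>1 + k\<bar> * E (k + 1) t + \<bar>k\<bar> * E (k - 1) t + x * E (k + 2) t)"
  define F where "F = (\<lambda>t. sinh t * E k t)"
  have E_nonneg: "E j t \<ge> 0" for j t
    by (simp add: E_def)
  have "integral {0..} f = 0 - F 0"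
  proof (rule integral_atLeast_FTC)
    show "(F has_field_derivative f t) (at t)" for t
    proof -
      define c where "c = cosh t"
      have c: "c > 0" by (simp add: c_def)
      have s: "sinh t * sinh t = c\<^sup>2 - 1"
        using sinh_square_eq[of t] by (simp add: c_def power2_eq_square)
      have "(F has_field_derivative (cosh t * E k t - x * (sinh t * sinh t) * E k t
          + k * (sinh t * sinh t) * E (k - 1) t)) (at t)"
        unfolding F_def E_def
        by (auto intro!: derivative_eq_intros simp: algebra_simps)
      \<comment> \<open>Factoring out the lowest power leaves a polynomial identity in
        \<open>c\<close>, whatever the sign of \<open>k\<close>.\<close>
      also have "E k t = E (k - 1) t * c" "E (k + 1) t = E (k - 1) t * c\<^sup>2" "E (k + 2) t = E (k - 1) t * c ^ 3"
        using power_int_add[of c "k - 1" 1] power_int_add[of c "k - 1" 2] power_int_add[of c "k - 1" 3] c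
        by (simp_all add: E_def c_def[symmetric] add.commute[of k])
      hence "cosh t * E k t - x * (sinh t * sinh t) * E k t + k * (sinh t * sinh t) * E (k - 1) t = f t"
        unfolding f_def s c_def[symmetric] by (simp only:) (simp add: algebra_simps power2_eq_square power3_eq_cube)
      finally show ?thesis .
    qed
    show "h integrable_on {0..}"
      unfolding h_def by (intro integrable_add integrable_on_mult_right int)
    show "\<bar>f t\<bar> \<le> h t" for t
    proof -
      have "\<bar>x * E k t\<bar> = x * E k t" "\<bar>(1 + k) * E (k + 1) t\<bar> = \<bar>1 + k\<bar> * E (k + 1) t"
        "\<bar>k * E (k - 1) t\<bar> = \<bar>k\<bar> * E (k - 1) t" "\<bar>x * E (k + 2) t\<bar> = x * E (k + 2) t"
        using x E_nonneg by (auto simp: abs_mult)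
      thus ?thesis unfolding f_def h_def by linarith
    qed
    \<comment> \<open>The factor sinh t costs one power of cosh, hence the exponent k + 1.\<close>
    obtain C where C: "exp (- (x * c)) * c powi (k + 1) \<le> C / c" if "c \<ge> 1" for c
      using exp_mult_powi_le[OF x] by blast
    have "\<bar>F t\<bar> \<le> C / cosh t" for t
    proof -
      have "\<bar>sinh t\<bar> \<le> cosh t"
        using sinh_le_cosh_real[of "\<bar>t\<bar>"] by (simp flip: sinh_real_abs)
      hence "\<bar>F t\<bar> \<le> cosh t * E k t"
        using E_nonneg by (auto simp: F_def abs_mult intro!: mult_right_mono)
      also have "\<dots> = exp (- (x * cosh t)) * cosh t powi (k + 1)"
        by (simp add: E_def power_int_add)
      finally show ?thesis using C[OF cosh_real_ge_1[of t]] by linarith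
    qed
    moreover have "((\<lambda>t::real. C / cosh t) \<longlongrightarrow> 0) at_top"
      by (intro real_tendsto_divide_at_top[OF tendsto_const] cosh_real_at_top)
    ultimately show "(F \<longlongrightarrow> 0) at_top"
      by (intro Lim_null_comparison[of F]) auto
  qed
  moreover have "integral {0..} f = x * integral {0..} (E k) + (1 + k) * integral {0..} (E (k + 1))
     - k * integral {0..} (E (k - 1)) - x * integral {0..} (E (k + 2))"
    unfolding f_def by (simp add: integral_add integral_diff int integrable_add integrable_diff integrable_on_mult_right)
  ultimately show ?thesis
    by (simp add: exp_cosh_moment_def E_def F_def)
qed

text \<open>Differentiation under the integral sign by \<open>exp_remainder_le\<close> with v = - h
  cosh t. The square of v raises the exponent to k + 2; for \<bar>h\<bar> < x / 2 the factor exp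
  \<bar>v\<bar> costs at most half of the decay, so M_(k+2)(x / 2) is a uniform constant.\<close>

lemma exp_cosh_moment_deriv:
  assumes x: "x > 0"
  shows "(exp_cosh_moment k has_field_derivative - exp_cosh_moment (k + 1) x) (at x)"
proof (rule has_field_derivative_quadratic_remainder)
  show "x / 2 > 0" using x by simp
  define E where "E = (\<lambda>j y t. exp (- (y * cosh t)) * cosh t powi j :: real)"
  have int: "E j y integrable_on {0..}" if "y > 0" for j y
    unfolding E_def using exp_cosh_powi_integrable that by blast
  have M: "exp_cosh_moment j y = integral {0..} (E j y)" for j y
    by (simp add: exp_cosh_moment_def E_def)
  show "\<bar>exp_cosh_moment k (x + h) - exp_cosh_moment k x - h * - exp_cosh_moment (k + 1) x\<bar>
      \<le> exp_cosh_moment (k + 2) (x / 2) * h\<^sup>2" if h: "\<bar>h\<bar> < x / 2" for h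
  proof -
    have xh: "x + h > 0" using h x by linarith
    let ?g = "\<lambda>t. E k (x + h) t - E k x t + h * E (k + 1) x t"
    have "norm (integral {0..} ?g) \<le> integral {0..} (\<lambda>t. h\<^sup>2 * E (k + 2) (x / 2) t)"
    proof (rule integral_norm_bound_integral)
      show "?g integrable_on {0..}" "(\<lambda>t. h\<^sup>2 * E (k + 2) (x / 2) t) integrable_on {0..}"
        using x xh by (intro integrable_add integrable_diff integrable_on_mult_right int; simp)+
      show "norm (?g t) \<le> h\<^sup>2 * E (k + 2) (x / 2) t" for t
      proof -
        define c where "c = cosh t"
        have c: "c > 0" by (simp add: c_def)
        have "?g t = E k x t * (exp (- (h * c)) - 1 - (- (h * c)))"
          using c by (simp add: E_def c_def[symmetric] power_int_add exp_add[symmetric] algebra_simps)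
        also have "\<bar>\<dots>\<bar> = E k x t * \<bar>exp (- (h * c)) - 1 - (- (h * c))\<bar>"
          by (subst abs_mult) (simp add: E_def)
        also have "\<dots> \<le> E k x t * ((- (h * c))\<^sup>2 * exp \<bar>- (h * c)\<bar>)"
          by (intro mult_left_mono exp_remainder_le) (simp add: E_def)
        also have "\<dots> = h\<^sup>2 * (exp (- (x * c) + \<bar>h\<bar> * c) * c powi (k + 2))"
          using c by (simp add: E_def c_def[symmetric] power_int_add exp_diff exp_minus
            divide_inverse abs_mult power_mult_distrib)
        also have "\<dots> \<le> h\<^sup>2 * (exp (- (x / 2 * c)) * c powi (k + 2))"
        proof (intro mult_left_mono mult_right_mono)
          have "\<bar>h\<bar> * c \<le> x / 2 * c"
            using h c by (intro mult_right_mono) auto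
          thus "exp (- (x * c) + \<bar>h\<bar> * c) \<le> exp (- (x / 2 * c))" by simp
        qed (use c in auto)
        finally show ?thesis by (simp add: E_def c_def)
      qed
    qed
    moreover have "integral {0..} ?g = integral {0..} (E k (x + h)) - integral {0..} (E k x)
        + h * integral {0..} (E (k + 1) x)"
      using x xh by (simp add: integral_add integral_diff int integrable_diff integrable_on_mult_right)
    ultimately show ?thesis
      by (simp add: M mult.commute)
  qed
qed

section \<open>Bickley and Bessel functions as moments\<close>

text \<open>The substitution is the Gudermannian \<theta> = arctan (sinh t), with d\<theta> = dt /
  cosh t. This Jacobian raises the exponent n - 1 to n.\<close>

lemma Ki_eq_exp_cosh_moment:
  assumes x: "x > 0 \<or> x = 0 \<and> n \<ge> 1"
  shows "Ki n x = exp_cosh_moment (- int n) x"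
proof -
  define f where "f = (\<lambda>\<theta>. exp (- (x / cos \<theta>)) * cos \<theta> powi (int n - 1))"
  define g where "g = (\<lambda>t::real. arctan (sinh t))"
  have cos_g: "cos (g t) = 1 / cosh t" for t
  proof -
    have "sqrt (1 + (sinh t)\<^sup>2) = cosh t"
      by (rule real_sqrt_unique) (auto simp: cosh_square_eq)
    thus ?thesis by (simp add: g_def cos_arctan)
  qed
  have eq: "\<bar>1 / cosh t\<bar> * f (g t) = exp (- (x * cosh t)) * cosh t powi (- int n)" for t
  proof -
    have "\<bar>1 / cosh t\<bar> * f (g t) = exp (- (x * cosh t)) * ((1 / cosh t) powi 1 * (1 / cosh t) powi (int n - 1))"
      by (simp add: f_def cos_g)
    also have "(1 / cosh t) powi 1 * (1 / cosh t) powi (int n - 1) = (1 / cosh t) powi int n"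
      by (subst power_int_add[symmetric]) auto
    finally show ?thesis
      by (simp add: power_int_minus power_one_over divide_inverse flip: power_inverse)
  qed
  have abs_int: "(\<lambda>t. \<bar>1 / cosh t\<bar> * f (g t)) absolutely_integrable_on {0..}"
    unfolding eq by (intro nonnegative_absolutely_integrable_1 exp_cosh_powi_integrable) (use x in auto)
  have "(\<lambda>t. \<bar>1 / cosh t\<bar> * f (g t)) absolutely_integrable_on {0..} \<and>
      integral {0..} (\<lambda>t. \<bar>1 / cosh t\<bar> * f (g t)) = exp_cosh_moment (- int n) x
    \<longleftrightarrow> f absolutely_integrable_on (g ` {0..}) \<and> integral (g ` {0..}) f = exp_cosh_moment (- int n) x"
  proof (rule has_absolute_integral_change_of_variables_1')
    show "(g has_field_derivative 1 / cosh t) (at t within {0..})" for t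
      unfolding g_def using cosh_square_eq[of t]
      by (auto intro!: derivative_eq_intros simp: power2_eq_square field_simps)
    show "inj_on g {0..}"
      by (auto simp: g_def inj_on_def arctan_eq_iff)
  qed auto
  moreover have "integral {0..} (\<lambda>t. \<bar>1 / cosh t\<bar> * f (g t)) = exp_cosh_moment (- int n) x"
    unfolding eq exp_cosh_moment_def ..
  ultimately have "integral (g ` {0..}) f = exp_cosh_moment (- int n) x"
    using abs_int by blast
  \<comment> \<open>The preimage of y is arsinh (tan y). The endpoint pi/2 is never reached and is
    restored below as a null set.\<close>
  moreover have "g ` {0..} = {0..<pi/2}"
  proof (intro set_eqI iffI)
    fix y assume y: "y \<in> {0..<pi/2}"
    hence t: "tan y \<ge> 0" "arctan (tan y) = y"
      by (auto simp: arctan_tan tan_pos_pi2_le intro: arctan_tan)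
    have "y = g (arsinh (tan y))"
      using t by (simp add: g_def sinh_arsinh_real)
    moreover have "sinh (arsinh (tan y)) \<ge> 0"
      using t by (simp add: sinh_arsinh_real)
    hence "arsinh (tan y) \<ge> 0"
      by (simp only: sinh_real_nonneg_iff)
    ultimately show "y \<in> g ` {0..}" by auto
  qed (use arctan_ubound in \<open>auto simp: g_def\<close>)
  moreover have "integral {0..<pi/2} f = integral {0..pi/2} f"
  proof (rule integral_subset_negligible)
    have "{0..pi / 2} - {0..<pi / 2} = {pi/2}" by auto
    thus "negligible ({0..pi / 2} - {0..<pi / 2})" by simp
  qed auto
  ultimately show ?thesis
    by (simp add: Ki_def f_def)
qed

lemma bessel_K_eq_exp_cosh_moment:
  "bessel_K 0 x = exp_cosh_moment 0 x" "bessel_K 1 x = exp_cosh_moment 1 x"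
  by (simp_all add: bessel_K_def exp_cosh_moment_def)


section \<open>Limits and bounds near 0, and the derivatives of K_0 and x K_1\<close>

text \<open>At \<open>x = 0\<close> the integrand of \<open>Ki 1\<close> is constantly 1, which gives \<open>\<integral> 1 / cosh t\<close> for free.\<close>

lemma exp_cosh_moment_minus_1_0: "exp_cosh_moment (-1) 0 = pi / 2"
proof -
  have "Ki 1 0 = pi / 2"
    by (simp add: Ki_def)
  thus ?thesis
    using Ki_eq_exp_cosh_moment[of 0 1] by simp
qed

text \<open>As cosh t \<ge> 1, the integrand is at most 1 / cosh t, the integrand of
  M_(-1)(0).\<close>

lemma exp_cosh_moment_le_pi_half:
  assumes "x > 0" "k \<le> -1"
  shows "0 \<le> exp_cosh_moment k x" "exp_cosh_moment k x \<le> pi / 2"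
proof -
  note int = exp_cosh_powi_integrable[of x k] exp_cosh_powi_integrable[of 0 "-1"]
  show "0 \<le> exp_cosh_moment k x"
    unfolding exp_cosh_moment_def by (intro integral_nonneg int) (use assms in auto)
  have "exp_cosh_moment k x \<le> exp_cosh_moment (-1) 0"
    unfolding exp_cosh_moment_def
  proof (intro integral_le int)
    show "exp (- (x * cosh t)) * cosh t powi k \<le> exp (- (0 * cosh t)) * cosh t powi - 1" for t
      using assms cosh_real_ge_1[of t] by (intro mult_mono power_int_increasing) auto
  qed (use assms in auto)
  also note exp_cosh_moment_minus_1_0
  finally show "exp_cosh_moment k x \<le> pi / 2" .
qed

lemma tendsto_exp_cosh_moment_at_0:
  "(\<lambda>n. exp_cosh_moment (-1) (inverse (real (Suc n)))) \<longlonglongrightarrow> pi / 2"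
proof -
  have "(\<lambda>n. exp_cosh_moment (-1) (inverse (real (Suc n)))) \<longlonglongrightarrow> exp_cosh_moment (-1) 0"
    unfolding exp_cosh_moment_def
  proof (rule dominated_convergence(2)[OF exp_cosh_powi_integrable integrable_inverse_cosh])
    show "(\<lambda>n. exp (- (inverse (real (Suc n)) * cosh t)) * cosh t powi - 1)
        \<longlonglongrightarrow> exp (- (0 * cosh t)) * cosh t powi - 1" for t
      by (intro tendsto_intros LIMSEQ_inverse_real_of_nat)
  qed (auto simp: abs_mult power_int_minus divide_inverse)
  thus ?thesis
    unfolding exp_cosh_moment_minus_1_0 .
qed

text \<open>K_0 is unbounded near 0, but u exp (- u) \<le> 1 with u = x cosh t gives x exp (- x cosh
  t) \<le> 1 / cosh t. Dominated convergence then replaces an asymptotic expansion of K_0.\<close>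

lemma tendsto_mult_exp_cosh_moment_at_0:
  "(\<lambda>n. inverse (real (Suc n)) * exp_cosh_moment 0 (inverse (real (Suc n)))) \<longlonglongrightarrow> 0"
proof -
  define f where "f = (\<lambda>n t. inverse (real (Suc n)) * (exp (- (inverse (real (Suc n)) * cosh t)) * cosh t powi 0))"
  have "(\<lambda>n. integral {0..} (f n)) \<longlonglongrightarrow> integral {0..} (\<lambda>t::real. 0)"
  proof (rule dominated_convergence(2)[OF _ integrable_inverse_cosh])
    show "f n integrable_on {0..}" for n
      unfolding f_def by (intro integrable_on_mult_right exp_cosh_powi_integrable) auto
    show "norm (f n t) \<le> 1 / cosh t" for n t
    proof -
      define u where "u = inverse (real (Suc n)) * cosh t"
      have "u \<le> exp u"
        using exp_ge_add_one_self[of u] by linarith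
      hence "u * exp (- u) \<le> exp u * exp (- u)"
        by (intro mult_right_mono) auto
      hence "f n t * cosh t \<le> 1"
        by (simp add: f_def u_def exp_minus field_simps)
      thus ?thesis by (simp add: f_def field_simps)
    qed
    have "(\<lambda>n. inverse (real (Suc n)) * (exp (- (inverse (real (Suc n)) * cosh t)) * cosh t powi 0))
        \<longlonglongrightarrow> 0 * (exp (- (0 * cosh t)) * cosh t powi 0)" for t
      by (intro tendsto_intros LIMSEQ_inverse_real_of_nat)
    thus "(\<lambda>n. f n t) \<longlonglongrightarrow> 0" for t
      by (simp add: f_def)
  qed
  thus ?thesis
    by (simp add: f_def exp_cosh_moment_def)
qed

text \<open>At k = -1 the middle term of the recurrence vanishes, leaving x K_1 = x M_(-1) + M_(-2),
  and each moment is at most pi / 2. This keeps x K_1 bounded as x tends to 0.\<close>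

lemma mult_bessel_K_1_le:
  assumes "x > 0"
  shows "\<bar>x * bessel_K 1 x\<bar> \<le> (x + 1) * (pi / 2)"
proof -
  have "x * exp_cosh_moment 1 x = x * exp_cosh_moment (-1) x + exp_cosh_moment (-2) x"
    using exp_cosh_moment_recurrence[OF assms, of "-1"] by simp
  moreover have "0 \<le> x * exp_cosh_moment (-1) x" "x * exp_cosh_moment (-1) x \<le> x * (pi / 2)"
    using exp_cosh_moment_le_pi_half[of x "-1"] assms by auto
  moreover have "(x + 1) * (pi / 2) = x * (pi / 2) + pi / 2"
    by (simp add: algebra_simps)
  moreover have "0 \<le> exp_cosh_moment (-2) x" "exp_cosh_moment (-2) x \<le> pi / 2"
    using exp_cosh_moment_le_pi_half[of x "-2"] assms by auto
  ultimately show ?thesis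
    unfolding bessel_K_eq_exp_cosh_moment by linarith
qed

text \<open>The second rule is M_1 - x M_2 = - x M_0, the recurrence at k = 0. Using x K_1 instead
  of K_1 avoids a term K_1 / x.\<close>

lemma bessel_K_derivs:
  assumes "x > 0"
  shows "(bessel_K 0 has_field_derivative - bessel_K 1 x) (at x)"
    and "((\<lambda>x. x * bessel_K 1 x) has_field_derivative - (x * bessel_K 0 x)) (at x)"
proof -
  have [simp]: "bessel_K 0 = exp_cosh_moment 0" "bessel_K 1 = exp_cosh_moment 1"
    by (auto simp: bessel_K_eq_exp_cosh_moment)
  show "(bessel_K 0 has_field_derivative - bessel_K 1 x) (at x)"
    using exp_cosh_moment_deriv[OF assms, of 0] by simp
  show "((\<lambda>x. x * bessel_K 1 x) has_field_derivative - (x * bessel_K 0 x)) (at x)"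
    using exp_cosh_moment_recurrence[OF assms, of 0]
    by (auto intro!: derivative_eq_intros exp_cosh_moment_deriv[OF assms]
        simp: algebra_simps)
qed

section \<open>Power series and derivatives of the Struve functions\<close>

text \<open>The Euler operator y d/dy multiplies the n-th coefficient by n without shifting the
  index, so differential relations become termwise identities.\<close>

lemma power_series_deriv_times_id:
  fixes c :: "nat \<Rightarrow> real"
  assumes summ: "\<And>y. summable (\<lambda>n. c n * y ^ n)"
  obtains D where "((\<lambda>y. \<Sum>n. c n * y ^ n) has_field_derivative D) (at y)"
    and "(\<lambda>n. real n * c n * y ^ n) sums (y * D)"
proof
  show "((\<lambda>y. \<Sum>n. c n * y ^ n) has_field_derivative (\<Sum>n. diffs c n * y ^ n)) (at y)"
    by (rule termdiffs_strong_converges_everywhere[OF summ])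
  have "(\<lambda>n. real n * c n * y ^ (n - Suc 0)) sums (\<Sum>n. diffs c n * y ^ n)"
    using diffs_equiv[OF termdiff_converges_all[OF summ]] by simp
  from sums_mult[OF this, of y]
  show "(\<lambda>n. real n * c n * y ^ n) sums (y * (\<Sum>n. diffs c n * y ^ n))"
  proof (rule sums_cong[THEN iffD1, rotated])
    \<comment> \<open>At n = 0 the truncated exponent does no harm because the factor
      \<open>real n\<close> is 0.\<close>
    show "y * (real n * c n * y ^ (n - Suc 0)) = real n * c n * y ^ n" for n
      by (cases n) auto
  qed
qed

lemma Gamma_shift_half: "Gamma (real m + 3/2) = (real m + 1/2) * Gamma (real m + 1/2)"
proof -
  have "real m + 1/2 \<notin> \<int>\<^sub>\<le>\<^sub>0"
    using nonpos_Ints_nonpos[of "real m + 1/2"] by auto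
  from Gamma_plus1[OF this] show ?thesis
    by (simp add: add.assoc)
qed

text \<open>Each step multiplies Gamma by m + 3/2 and the factorial only by m + 1, starting from
  Gamma (3/2) = sqrt pi / 2.\<close>

lemma Gamma_half_lower_bound: "sqrt pi / 2 * fact m \<le> Gamma (real m + 3/2)"
proof (induction m)
  case 0
  show ?case using Gamma_shift_half[of 0] by (simp add: Gamma_one_half_real)
next
  case (Suc m)
  have "sqrt pi / 2 * fact (Suc m) = (real m + 1) * (sqrt pi / 2 * fact m)"
    by simp
  also have "\<dots> \<le> (real m + 3/2) * Gamma (real m + 3/2)"
    using Suc.IH by (intro mult_mono) auto
  also have "\<dots> = Gamma (real (Suc m) + 3/2)"
    using Gamma_shift_half[of "Suc m"] by (simp add: add_ac)
  finally show ?case .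
qed

text \<open>With \<open>y = x\<^sup>2 / 4\<close>, \<open>struve_L 0 x = (x / 2) f\<^sub>0(y)\<close> and \<open>struve_L (-1) x = f\<^sub>1(y)\<close>, where \<open>f\<^sub>0\<close> and \<open>f\<^sub>1\<close>
  are the entire power series with the following coefficients.\<close>

definition struve_coeff0 :: "nat \<Rightarrow> real" where
  "struve_coeff0 m = 1 / (Gamma (real m + 3/2))\<^sup>2"

definition struve_coeff1 :: "nat \<Rightarrow> real" where
  "struve_coeff1 m = 1 / (Gamma (real m + 3/2) * Gamma (real m + 1/2))"

text \<open>Coefficient form of L_0' = L_(-1).\<close>

lemma struve_coeff1_eq: "struve_coeff1 m = (real m + 1/2) * struve_coeff0 m"
  using Gamma_real_pos[of "real m + 1/2"]
  by (simp add: struve_coeff0_def struve_coeff1_def Gamma_shift_half power2_eq_square)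

text \<open>Coefficient form of (x L_(-1))' = 2/pi + x L_0, apart from the constant term.\<close>

lemma struve_coeff_shift: "(2 * real (Suc m) + 1) * struve_coeff1 (Suc m) = 2 * struve_coeff0 m"
proof -
  have "(2 * real (Suc m) + 1) * struve_coeff1 (Suc m) = 2 * (real (Suc m) + 1/2)^2 * struve_coeff0 (Suc m)"
    by (simp add: struve_coeff1_eq power2_eq_square algebra_simps)
  also have "struve_coeff0 (Suc m) = struve_coeff0 m / (real (Suc m) + 1/2)^2"
    using Gamma_shift_half[of "Suc m"] by (simp add: struve_coeff0_def power_mult_distrib add_ac)
  finally show ?thesis by simp
qed

lemma summable_struve_coeff0: "summable (\<lambda>m. struve_coeff0 m * y ^ m)"
proof (rule summable_comparison_test')
  show "summable (\<lambda>m. 4 / pi * (inverse (fact m) * \<bar>y\<bar> ^ m))"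
    by (intro summable_mult summable_exp)
  show "norm (struve_coeff0 m * y ^ m) \<le> 4 / pi * (inverse (fact m) * \<bar>y\<bar> ^ m)" for m
  proof -
    \<comment> \<open>Dropping one of the two factorials leaves the exponential series as
      majorant.\<close>
    have "pi / 4 * fact m \<le> pi / 4 * (fact m * fact m)"
      using fact_ge_1[of m, where 'a = real] by simp
    also have "\<dots> = (sqrt pi / 2 * fact m)\<^sup>2"
      by (simp add: power2_eq_square)
    also have "\<dots> \<le> (Gamma (real m + 3/2))\<^sup>2"
      by (intro power_mono Gamma_half_lower_bound) simp
    finally have "inverse ((Gamma (real m + 3/2))\<^sup>2) \<le> inverse (pi / 4 * fact m)"
      by (rule le_imp_inverse_le) simp
    hence "struve_coeff0 m \<le> 1 / (pi / 4 * fact m)"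
      by (simp only: struve_coeff0_def inverse_eq_divide)
    also have "\<dots> = 4 / pi * inverse (fact m)"
      by (simp add: field_simps)
    finally have "struve_coeff0 m * \<bar>y\<bar> ^ m \<le> 4 / pi * inverse (fact m) * \<bar>y\<bar> ^ m"
      by (intro mult_right_mono) auto
    thus ?thesis
      by (simp add: abs_mult power_abs struve_coeff0_def mult.assoc)
  qed
qed

text \<open>The operator y d/dy + 1/2 multiplies the m-th coefficient by m + 1/2 and so sends f_0 to
  f_1; convergence of f_1 comes along.\<close>

lemma sums_struve_coeff0_deriv:
  obtains D where "((\<lambda>y. \<Sum>m. struve_coeff0 m * y ^ m) has_field_derivative D) (at y)"
    and "(\<lambda>m. struve_coeff1 m * y ^ m) sums (y * D + (\<Sum>m. struve_coeff0 m * y ^ m) / 2)"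
proof -
  obtain D where D: "((\<lambda>y. \<Sum>m. struve_coeff0 m * y ^ m) has_field_derivative D) (at y)"
    "(\<lambda>m. real m * struve_coeff0 m * y ^ m) sums (y * D)"
    using power_series_deriv_times_id[OF summable_struve_coeff0] by blast
  have "(\<lambda>m. real m * struve_coeff0 m * y ^ m + struve_coeff0 m * y ^ m / 2) sums
      (y * D + (\<Sum>m. struve_coeff0 m * y ^ m) / 2)"
    by (intro sums_add D sums_divide summable_sums summable_struve_coeff0)
  also have "(\<lambda>m. real m * struve_coeff0 m * y ^ m + struve_coeff0 m * y ^ m / 2) =
      (\<lambda>m. struve_coeff1 m * y ^ m)"
    by (simp add: struve_coeff1_eq algebra_simps)
  finally show ?thesis using D(1) that by blast
qed

lemma summable_struve_coeff1: "summable (\<lambda>m. struve_coeff1 m * y ^ m)"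
  using sums_struve_coeff0_deriv[of y] sums_summable by blast

lemma struve_L_0_eq:
  assumes "x > 0"
  shows "struve_L 0 x = x / 2 * (\<Sum>m. struve_coeff0 m * (x\<^sup>2 / 4) ^ m)"
proof -
  have "(x / 2) powr (2 * real m + 0 + 1) / (Gamma (real m + 3/2) * Gamma (real m + 0 + 3/2)) =
      x / 2 * (struve_coeff0 m * (x\<^sup>2 / 4) ^ m)" for m
  proof -
    have "(x / 2) powr (2 * real m + 0 + 1) = (x / 2) powr real (Suc (2 * m))"
      by (simp add: add_ac)
    also have "\<dots> = x / 2 * ((x / 2)\<^sup>2) ^ m"
      using assms by (subst powr_realpow) (auto simp flip: power_mult)
    finally have pow: "(x / 2) powr (2 * real m + 0 + 1) = x / 2 * (x\<^sup>2 / 4) ^ m"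
      by (simp add: power_divide)
    show ?thesis
      unfolding pow by (simp add: struve_coeff0_def power2_eq_square)
  qed
  thus ?thesis
    unfolding struve_L_def by (simp only: suminf_mult[OF summable_struve_coeff0])
qed

lemma struve_L_minus_1_eq:
  assumes "x > 0"
  shows "struve_L (-1) x = (\<Sum>m. struve_coeff1 m * (x\<^sup>2 / 4) ^ m)"
proof -
  have "(x / 2) powr (2 * real m + -1 + 1) / (Gamma (real m + 3/2) * Gamma (real m + -1 + 3/2)) =
      struve_coeff1 m * (x\<^sup>2 / 4) ^ m" for m
  proof -
    have "(x / 2) powr (2 * real m + -1 + 1) = (x / 2) powr real (2 * m)"
      by simp
    also have "\<dots> = ((x / 2)\<^sup>2) ^ m"
      using assms by (subst powr_realpow) (auto simp flip: power_mult)
    finally have pow: "(x / 2) powr (2 * real m + -1 + 1) = (x\<^sup>2 / 4) ^ m"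
      by (simp add: power_divide)
    have shift: "real m + -1 + 3/2 = real m + 1/2" by simp
    show ?thesis
      unfolding pow shift struve_coeff1_def by simp
  qed
  thus ?thesis
    unfolding struve_L_def by simp
qed

lemma struve_L_0_deriv:
  assumes "x > 0"
  shows "(struve_L 0 has_field_derivative struve_L (-1) x) (at x)"
proof -
  define y where "y = x\<^sup>2 / 4"
  define f0 where "f0 = (\<lambda>y. \<Sum>m. struve_coeff0 m * y ^ m)"
  obtain D where D: "(f0 has_field_derivative D) (at y)"
    "(\<lambda>m. struve_coeff1 m * y ^ m) sums (y * D + f0 y / 2)"
    unfolding f0_def using sums_struve_coeff0_deriv by blast
  have chain: "((\<lambda>x. f0 (x\<^sup>2 / 4)) has_field_derivative D * (x / 2)) (at x)"
    by (rule DERIV_chain2[where g = "\<lambda>x. x\<^sup>2 / 4"], rule D(1)[unfolded y_def])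
       (auto intro!: derivative_eq_intros)
  have "((\<lambda>x. x / 2) has_field_derivative 1 / 2) (at x)"
    by (auto intro!: derivative_eq_intros)
  \<comment> \<open>The chain rule contributes (x/2) (x/2) D, which is y D.\<close>
  from DERIV_mult'[OF this chain]
  have "((\<lambda>x. x / 2 * f0 (x\<^sup>2 / 4)) has_field_derivative
      (y * D + f0 y / 2)) (at x)"
    by (simp add: y_def power2_eq_square algebra_simps)
  hence "(struve_L 0 has_field_derivative (y * D + f0 y / 2)) (at x)"
    by (rule has_field_derivative_transform_within_open[where S = "{0<..}"])
       (use assms in \<open>auto simp: struve_L_0_eq f0_def\<close>)
  moreover have "struve_L (-1) x = y * D + f0 y / 2"
    using sums_unique[OF D(2)] struve_L_minus_1_eq[OF assms] by (simp add: y_def)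
  ultimately show ?thesis by simp
qed

text \<open>Differentiating x f_1(x^2/4) gives 2 y f_1' + f_1, whose m-th coefficient is (2 m + 1)
  times that of f_1. Shifting the index identifies this with 2 y f_0 = x L_0 plus the term m =
  0.\<close>

lemma mult_struve_L_minus_1_deriv:
  assumes "x > 0"
  shows "((\<lambda>x. x * struve_L (-1) x) has_field_derivative (2 / pi + x * struve_L 0 x)) (at x)"
proof -
  define y where "y = x\<^sup>2 / 4"
  define f0 where "f0 = (\<lambda>y. \<Sum>m. struve_coeff0 m * y ^ m)"
  define f1 where "f1 = (\<lambda>y. \<Sum>m. struve_coeff1 m * y ^ m)"
  obtain D where D: "(f1 has_field_derivative D) (at y)"
    "(\<lambda>m. real m * struve_coeff1 m * y ^ m) sums (y * D)"
    unfolding f1_def using power_series_deriv_times_id[OF summable_struve_coeff1] by blast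
  have "(\<lambda>m. 2 * (real m * struve_coeff1 m * y ^ m) + struve_coeff1 m * y ^ m) sums (2 * (y * D) + f1 y)"
    unfolding f1_def by (intro sums_add sums_mult D summable_sums summable_struve_coeff1)
  hence "(\<lambda>m. (2 * real m + 1) * struve_coeff1 m * y ^ m) sums (2 * (y * D) + f1 y)"
    by (simp add: algebra_simps)
  moreover have "(\<lambda>m. (2 * real m + 1) * struve_coeff1 m * y ^ m) sums (2 * y * f0 y + 2 / pi)"
  proof -
    have "(\<lambda>m. 2 * y * (struve_coeff0 m * y ^ m)) sums (2 * y * f0 y)"
      unfolding f0_def by (intro sums_mult summable_sums summable_struve_coeff0)
    also have "(\<lambda>m. 2 * y * (struve_coeff0 m * y ^ m)) =
        (\<lambda>m. (2 * real (Suc m) + 1) * struve_coeff1 (Suc m) * y ^ Suc m)"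
      unfolding struve_coeff_shift by (simp add: mult_ac)
    \<comment> \<open>The shifted series covers m \<ge> 1; the term m = 0 is added back and supplies
      2/pi.\<close>
    finally have "(\<lambda>m. (2 * real m + 1) * struve_coeff1 m * y ^ m) sums
        (2 * y * f0 y + (2 * real 0 + 1) * struve_coeff1 0 * y ^ 0)"
      by (subst (asm) sums_Suc_iff) simp
    moreover have "struve_coeff1 0 = 2 / pi"
    proof -
      have G: "Gamma (3/2 :: real) = sqrt pi / 2"
        using Gamma_shift_half[of 0] by (simp add: Gamma_one_half_real)
      show ?thesis
        by (simp add: struve_coeff1_def Gamma_one_half_real G)
    qed
    ultimately show ?thesis by simp
  qed
  ultimately have eq: "2 * (y * D) + f1 y = 2 * y * f0 y + 2 / pi"
    by (rule sums_unique2)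
  have chain: "((\<lambda>x. f1 (x\<^sup>2 / 4)) has_field_derivative D * (x / 2)) (at x)"
    by (rule DERIV_chain2[where g = "\<lambda>x. x\<^sup>2 / 4"], rule D(1)[unfolded y_def])
       (auto intro!: derivative_eq_intros)
  have "((\<lambda>x. x) has_field_derivative 1) (at x)"
    by (auto intro!: derivative_eq_intros)
  from DERIV_mult'[OF this chain]
  have "((\<lambda>x. x * f1 (x\<^sup>2 / 4)) has_field_derivative (2 * (y * D) + f1 y)) (at x)"
    by (simp add: y_def power2_eq_square algebra_simps)
  hence "((\<lambda>x. x * struve_L (-1) x) has_field_derivative (2 * (y * D) + f1 y)) (at x)"
    by (rule has_field_derivative_transform_within_open[where S = "{0<..}"])
       (use assms in \<open>auto simp: struve_L_minus_1_eq f1_def\<close>)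
  also have "2 * (y * D) + f1 y = 2 / pi + x * struve_L 0 x"
    unfolding eq using struve_L_0_eq[OF assms] by (simp add: f0_def y_def power2_eq_square)
  finally show ?thesis .
qed

text \<open>Both series are continuous at 0, and the prefactor x/2 sends L_0 to 0. For L_(-1) a
  finite limit suffices, since it is multiplied by x K_0, which tends to 0.\<close>

lemma tendsto_struve_L_at_0:
  fixes x :: "nat \<Rightarrow> real"
  assumes x: "\<And>n. x n > 0" "x \<longlonglongrightarrow> 0"
  shows "(\<lambda>n. struve_L 0 (x n)) \<longlonglongrightarrow> 0" "convergent (\<lambda>n. struve_L (-1) (x n))"
proof -
  have cont: "isCont (\<lambda>y. \<Sum>m. struve_coeff0 m * y ^ m) 0" "isCont (\<lambda>y. \<Sum>m. struve_coeff1 m * y ^ m) 0"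
    by (rule DERIV_isCont termdiffs_strong_converges_everywhere summable_struve_coeff0 summable_struve_coeff1)+
  have x2: "(\<lambda>n. (x n)\<^sup>2 / 4) \<longlonglongrightarrow> 0"
    using x(2) by (auto intro!: tendsto_eq_intros)
  show "(\<lambda>n. struve_L 0 (x n)) \<longlonglongrightarrow> 0"
    using tendsto_mult[OF tendsto_divide[OF x(2) tendsto_const[of 2]] isCont_tendsto_compose[OF cont(1) x2]]
    by (simp add: struve_L_0_eq x(1))
  show "convergent (\<lambda>n. struve_L (-1) (x n))"
    using isCont_tendsto_compose[OF cont(2) x2]
    by (auto simp: struve_L_minus_1_eq x(1) convergent_def)
qed

section \<open>The constant combination and the closed forms\<close>

lemma Ki_1_eq:
  assumes "x > 0"
  shows "Ki 1 x = pi / 2 - pi * x / 2 * bickley_A x"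
proof -
  \<comment> \<open>The factor x is attached to L_(-1) in one product and to K_1 in the other,
    matching the available derivative rules.\<close>
  define F where "F = (\<lambda>x. exp_cosh_moment (-1) x + pi / 2 * (bessel_K 0 x * (x * struve_L (-1) x)
      + x * bessel_K 1 x * struve_L 0 x))"
  have deriv: "(F has_field_derivative 0) (at x)" if x: "x > 0" for x
  proof -
    have "(F has_field_derivative - exp_cosh_moment (-1 + 1) x + pi / 2 *
        ((bessel_K 0 x * (2 / pi + x * struve_L 0 x) + - bessel_K 1 x * (x * struve_L (-1) x)) +
         (x * bessel_K 1 x * struve_L (-1) x + - (x * bessel_K 0 x) * struve_L 0 x))) (at x)"
      unfolding F_def
      by (intro DERIV_add DERIV_cmult DERIV_mult' exp_cosh_moment_deriv bessel_K_derivs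
          struve_L_0_deriv mult_struve_L_minus_1_deriv x)
    \<comment> \<open>The terms x K_0 L_0 and x K_1 L_(-1) cancel in pairs, and (pi/2) (2/pi) K_0
      cancels - M_0.\<close>
    thus ?thesis
      by (simp add: algebra_simps bessel_K_eq_exp_cosh_moment)
  qed
  have "\<exists>c. \<forall>x\<in>{0<..}. F x = c"
    by (rule has_field_derivative_zero_constant)
       (auto intro: has_field_derivative_at_within deriv)
  then obtain c where c: "F x = c" if "x > 0" for x by auto
  define u where "u = (\<lambda>n. inverse (real (Suc n)))"
  have u: "u n > 0" "u \<longlonglongrightarrow> 0" for n
    using LIMSEQ_inverse_real_of_nat by (simp_all add: u_def)
  obtain L where L: "(\<lambda>n. struve_L (-1) (u n)) \<longlonglongrightarrow> L"
    using tendsto_struve_L_at_0(2)[of u] u by (auto simp: convergent_def)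
  have "(\<lambda>n. u n * bessel_K 0 (u n) * struve_L (-1) (u n)) \<longlonglongrightarrow> 0 * L"
    using tendsto_mult_exp_cosh_moment_at_0
    by (intro tendsto_mult L) (simp add: u_def bessel_K_eq_exp_cosh_moment)
  \<comment> \<open>A bounded factor x K_1 times L_0, which tends to 0.\<close>
  moreover have "(\<lambda>n. u n * bessel_K 1 (u n) * struve_L 0 (u n)) \<longlonglongrightarrow> 0"
  proof (rule Lim_null_comparison)
    show "\<forall>\<^sub>F n in sequentially. norm (u n * bessel_K 1 (u n) * struve_L 0 (u n))
        \<le> (u n + 1) * (pi / 2) * \<bar>struve_L 0 (u n)\<bar>"
    proof (intro always_eventually allI)
      show "norm (u n * bessel_K 1 (u n) * struve_L 0 (u n))
          \<le> (u n + 1) * (pi / 2) * \<bar>struve_L 0 (u n)\<bar>" for n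
        using mult_right_mono[OF mult_bessel_K_1_le[OF u(1)] abs_ge_zero]
        by (simp only: real_norm_def abs_mult)
    qed
    have "(\<lambda>n. (u n + 1) * (pi / 2) * \<bar>struve_L 0 (u n)\<bar>) \<longlonglongrightarrow> (0 + 1) * (pi / 2) * \<bar>0\<bar>"
      by (intro tendsto_intros u tendsto_struve_L_at_0(1))
    thus "(\<lambda>n. (u n + 1) * (pi / 2) * \<bar>struve_L 0 (u n)\<bar>) \<longlonglongrightarrow> 0" by simp
  qed
  moreover have "(\<lambda>n. exp_cosh_moment (-1) (u n)) \<longlonglongrightarrow> pi / 2"
    using tendsto_exp_cosh_moment_at_0 by (simp add: u_def)
  ultimately have "(\<lambda>n. exp_cosh_moment (-1) (u n) + pi / 2 *
      (u n * bessel_K 0 (u n) * struve_L (-1) (u n) + u n * bessel_K 1 (u n) * struve_L 0 (u n)))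
      \<longlonglongrightarrow> pi / 2 + pi / 2 * (0 * L + 0)"
    by (intro tendsto_add tendsto_mult_left)
  hence "(\<lambda>n. F (u n)) \<longlonglongrightarrow> pi / 2"
    by (simp add: F_def mult_ac)
  hence "c = pi / 2"
    using c u(1) by (simp add: LIMSEQ_const_iff)
  with c[OF assms] show ?thesis
    using Ki_eq_exp_cosh_moment[of x 1] assms by (simp add: F_def bickley_A_def algebra_simps)
qed

theorem corollary1:
  fixes x :: real
  assumes "x > 0"
  shows
    "Ki 2 x = - (pi * x / 2) + x * bessel_K 1 x
       + pi * x^2 / 2 * (bessel_K 0 x * struve_L (-1) x + bessel_K 1 x * struve_L 0 x) \<and>
     Ki 2 x = P2 x * bessel_K 1 x + Q2 x * bickley_A x + C2 x \<and>
     Ki 3 x = pi * (1 + x^2) / 4 + x / 2 * bessel_K 0 x - x^2 / 2 * bessel_K 1 x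
       - pi * x * (1 + x^2) / 4
         * (bessel_K 0 x * struve_L (-1) x + bessel_K 1 x * struve_L 0 x) \<and>
     Ki 3 x = P3 x * bessel_K 1 x + R3 x * bessel_K 0 x + Q3 x * bickley_A x + C3 x \<and>
     Ki 4 x = - (pi * x * (3 + x^2) / 12) - x^2 / 6 * bessel_K 0 x
       + x * (4 + x^2) / 6 * bessel_K 1 x
       + pi * x^2 * (3 + x^2) / 12
         * (bessel_K 0 x * struve_L (-1) x + bessel_K 1 x * struve_L 0 x) \<and>
     Ki 4 x = P4 x * bessel_K 1 x + R4 x * bessel_K 0 x + Q4 x * bickley_A x + C4 x"
proof -
  have Ki: "Ki n x = exp_cosh_moment (- int n) x" for n
    using assms by (simp add: Ki_eq_exp_cosh_moment)
  note rec = exp_cosh_moment_recurrence[OF assms]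
  \<comment> \<open>The recurrence at k = -1, -2, -3 is solved in turn for its lowest moment
    M_(k-1), which is Ki of order 1 - k.\<close>
  have 2: "Ki 2 x = x * bessel_K 1 x - x * Ki 1 x"
    using rec[of "-1"] by (simp add: Ki bessel_K_eq_exp_cosh_moment)
  have 3: "Ki 3 x = (Ki 1 x + x * bessel_K 0 x - x * Ki 2 x) / 2"
    using rec[of "-2"] by (simp add: Ki bessel_K_eq_exp_cosh_moment)
  have 4: "Ki 4 x = (2 * Ki 2 x + x * Ki 1 x - x * Ki 3 x) / 3"
    using rec[of "-3"] by (simp add: Ki)
  have K2: "Ki 2 x = P2 x * bessel_K 1 x + Q2 x * bickley_A x + C2 x"
    unfolding 2 Ki_1_eq[OF assms] P2_def Q2_def C2_def
    by (simp add: field_simps power2_eq_square)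
  have K3: "Ki 3 x = P3 x * bessel_K 1 x + R3 x * bessel_K 0 x + Q3 x * bickley_A x + C3 x"
    unfolding 3 K2 Ki_1_eq[OF assms] P2_def Q2_def C2_def P3_def R3_def Q3_def C3_def
    by (simp add: field_simps power2_eq_square)
  have K4: "Ki 4 x = P4 x * bessel_K 1 x + R4 x * bessel_K 0 x + Q4 x * bickley_A x + C4 x"
    unfolding 4 K3 K2 Ki_1_eq[OF assms] P2_def Q2_def C2_def P3_def R3_def Q3_def C3_def
      P4_def R4_def Q4_def C4_def
    by (simp add: field_simps power2_eq_square)
  show ?thesis
    using K2 K3 K4
    by (simp add: P2_def Q2_def C2_def P3_def R3_def Q3_def C3_def P4_def R4_def Q4_def C4_def
        bickley_A_def)
qed

end
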